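(* Let $\alpha\in(0,1)$, let $X$ and $Y$ be complex normed spaces, let $D\subseteq X$ be a $c$-uniform domain, and let $f:D\to Y$ be an analytic mapping. Then there is a constant $C_f$ such that $$\|df(z)\|_{X\to Y}\le C_f\,d(z,\partial D)^{\alpha-1},\quad z\in D,$$ if and only if $f$ is $\alpha$-Hölder continuous, i.e. there is a constant $C'_f$ such that $$\|f(z)-f(w)\|_Y\le C'_f\,\|z-w\|_X^\alpha,\quad z,w\in D.$$ Moreover, one has the estimates $C'_f\le\frac{2c}{\alpha}C_f$ and $C_f\le C'_f$; that is, if the first condition holds with constant $C_f$, then the second holds with some constant $C'_f\le\frac{2c}{\alpha}C_f$, and if the second condition holds with constant $C'_f$, then the first holds with some constant $C_f\le C'_f$.
   Context: A mapping $f:D\to Y$ on a domain (open connected set) $D$ of a complex normed space $X$ is analytic if it is (complex) Fréchet differentiable at every point of $D$; $df(z):X\to Y$ is the Fréchet differential, a continuous linear map, and $\|df(z)\|_{X\to Y}=\sup_{\|\zeta\|_X=1}\|df(z)\zeta\|_Y$. A domain $D$ with non-empty boundary in a normed space $X$ (complex normed spaces being regarded as real ones) is $c$-uniform if for every $x,y\in D$ there is a rectifiable arc $\gamma\subseteq D$ with endpoints $x$ and $y$ such that: (i) $\ell(\gamma)\le c\|x-y\|_X$; (ii) $\min\{\ell(\gamma[x,z]),\ell(\gamma[z,y])\}\le c\,d(z,\partial D)$ for every $z\in\gamma$. Here $\ell$ denotes length, $\gamma[z,w]$ is the part of the arc $\gamma$ between $z$ and $w$, and $d(z,\partial D)$ is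 the distance of $z$ from the boundary $\partial D$. *)

theory Defs
  imports "HOL-Analysis.Analysis"
begin

class complex_normed_vector = real_normed_vector +
  fixes scaleC :: "complex \<Rightarrow> 'a \<Rightarrow> 'a"  (infixr \<open>*\<^sub>C\<close> 75)
  assumes scaleC_add_right: "a *\<^sub>C (x + y) = a *\<^sub>C x + a *\<^sub>C y"
    and scaleC_add_left: "(a + b) *\<^sub>C x = a *\<^sub>C x + b *\<^sub>C x"
    and scaleC_scaleC: "a *\<^sub>C (b *\<^sub>C x) = (a * b) *\<^sub>C x"
    and scaleC_of_real: "complex_of_real r *\<^sub>C x = r *\<^sub>R x"
    and norm_scaleC: "norm (a *\<^sub>C x) = cmod a * norm x"

instantiation complex :: complex_normed_vector
begin

definition scaleC_complex :: "complex \<Rightarrow> complex \<Rightarrow> complex"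
  where "scaleC_complex a x = a * x"

instance
  by standard (simp_all add: scaleC_complex_def algebra_simps scaleR_conv_of_real norm_mult)

end

definition domain_set :: "'a::real_normed_vector set \<Rightarrow> bool"
  where "domain_set D \<longleftrightarrow> open D \<and> connected D \<and> D \<noteq> {}"

definition complex_frechet_differentiable ::
    "('a::complex_normed_vector \<Rightarrow> 'b::complex_normed_vector) \<Rightarrow> 'a \<Rightarrow> bool"
  where "complex_frechet_differentiable f z \<longleftrightarrow>
    (\<exists>L. (f has_derivative L) (at z) \<and> (\<forall>a \<zeta>. L (a *\<^sub>C \<zeta>) = a *\<^sub>C L \<zeta>))"

text \<open>For open \<open>D\<close> the differential at a point of \<open>D\<close> is unique and depends only on the values
  of \<open>f\<close> on \<open>D\<close>, so it is \<open>frechet_derivative f (at z)\<close>.\<close>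

definition analytic_mapping_on ::
    "('a::complex_normed_vector \<Rightarrow> 'b::complex_normed_vector) \<Rightarrow> 'a set \<Rightarrow> bool"
  where "analytic_mapping_on f D \<longleftrightarrow> (\<forall>z\<in>D. complex_frechet_differentiable f z)"

text \<open>The library's \<open>onorm L\<close> is the supremum of \<open>norm (L x) / norm x\<close> over all \<open>x\<close>; on a nontrivial
  space this is the supremum over the unit sphere.\<close>

lemma onorm_eq_Sup_sphere:
  fixes L :: "'a::real_normed_vector \<Rightarrow> 'b::real_normed_vector"
  assumes "bounded_linear L" and "(x0::'a) \<noteq> 0"
  shows "onorm L = (SUP \<zeta>\<in>{\<zeta>. norm \<zeta> = 1}. norm (L \<zeta>))"
proof (rule antisym)
  interpret bounded_linear L by fact
  have bdd: "bdd_above ((\<lambda>\<zeta>. norm (L \<zeta>)) ` {\<zeta>. norm \<zeta> = 1})"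
    using onorm[OF assms(1)] by (intro bdd_aboveI2[where M = "onorm L"]) (metis mem_Collect_eq mult.right_neutral)
  have unit: "norm (L \<zeta>) \<le> (SUP \<zeta>\<in>{\<zeta>. norm \<zeta> = 1}. norm (L \<zeta>))" if "norm \<zeta> = 1" for \<zeta>
    using that by (intro cSUP_upper bdd) auto
  have sgn1: "norm (sgn x0) = 1" using assms(2) by (simp add: norm_sgn)
  show "onorm L \<le> (SUP \<zeta>\<in>{\<zeta>. norm \<zeta> = 1}. norm (L \<zeta>))"
  proof (rule onorm_bound)
    show "0 \<le> (SUP \<zeta>\<in>{\<zeta>. norm \<zeta> = 1}. norm (L \<zeta>))"
      using unit[OF sgn1] norm_ge_zero order_trans by blast
    fix x show "norm (L x) \<le> (SUP \<zeta>\<in>{\<zeta>. norm \<zeta> = 1}. norm (L \<zeta>)) * norm x"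
    proof (cases "x = 0")
      case False
      then have "norm (L (sgn x)) \<le> (SUP \<zeta>\<in>{\<zeta>. norm \<zeta> = 1}. norm (L \<zeta>))"
        by (intro unit) (simp add: norm_sgn)
      moreover have "norm (L (sgn x)) = norm (L x) / norm x"
        by (simp add: sgn_div_norm scaleR divide_inverse mult.commute)
      ultimately show ?thesis using False by (simp add: divide_le_eq)
    qed (simp add: zero)
  qed
  show "(SUP \<zeta>\<in>{\<zeta>. norm \<zeta> = 1}. norm (L \<zeta>)) \<le> onorm L"
    using sgn1 onorm[OF assms(1)] by (intro cSUP_least) (auto, metis mult.right_neutral)
qed

text \<open>Length of the part of the curve \<open>g\<close> with parameters in \<open>[a, b]\<close>, for \<open>a \<le> b\<close>: the supremum
  of the lengths of inscribed polygons, possibly infinite.\<close>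

definition curve_length :: "(real \<Rightarrow> 'a::real_normed_vector) \<Rightarrow> real \<Rightarrow> real \<Rightarrow> ereal"
  where "curve_length g a b =
    (SUP (n, t) \<in> {(n::nat, t::nat \<Rightarrow> real). t 0 = a \<and> t n = b \<and> (\<forall>i<n. t i \<le> t (Suc i))}.
       ereal (\<Sum>i<n. norm (g (t (Suc i)) - g (t i))))"

definition rectifiable_arc :: "(real \<Rightarrow> 'a::real_normed_vector) \<Rightarrow> bool"
  where "rectifiable_arc g \<longleftrightarrow> arc g \<and> curve_length g 0 1 < \<infinity>"

text \<open>An arc is an injective path, so its endpoints differ; for \<open>x = y\<close> the degenerate arc \<open>{x}\<close> would
  satisfy both conditions trivially, so only \<open>x \<noteq> y\<close> is considered. Since the arc \<open>g\<close> is injective, a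
  point \<open>z\<close> of the arc is \<open>g s\<close> for exactly one \<open>s \<in> [0, 1]\<close>, and the two subarcs cut off
  by \<open>z\<close> correspond to \<open>[0, s]\<close> and \<open>[s, 1]\<close>.\<close>

definition uniform_domain :: "real \<Rightarrow> 'a::real_normed_vector set \<Rightarrow> bool"
  where "uniform_domain c D \<longleftrightarrow>
    domain_set D \<and> frontier D \<noteq> {} \<and>
    (\<forall>x\<in>D. \<forall>y\<in>D. x \<noteq> y \<longrightarrow>
      (\<exists>g. rectifiable_arc g \<and> path_image g \<subseteq> D \<and> pathstart g = x \<and> pathfinish g = y \<and>
        curve_length g 0 1 \<le> ereal (c * norm (x - y)) \<and>
        (\<forall>s\<in>{0..1}. min (curve_length g 0 s) (curve_length g s 1)
                      \<le> ereal (c * infdist (g s) (frontier D)))))"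

end

theory Submission
  imports Defs "HOL-Complex_Analysis.Complex_Analysis"
begin

text \<open>If the differential is bounded by \<open>C d(z)\<^sup>\<alpha>\<^sup>-\<^sup>1\<close>, integrate it along the arc \<open>\<gamma>\<close> of the uniformity
  condition from each endpoint to the middle: there \<open>d \<ge> s / c\<close> in terms of the length \<open>s\<close> from that
  endpoint, and \<open>s\<^sup>\<alpha>\<^sup>-\<^sup>1\<close> integrates to \<open>s\<^sup>\<alpha> / \<alpha>\<close>. Neither arc length parametrisation nor line integrals
  are needed: by concavity of \<open>s\<^sup>\<alpha>\<close> the increments of \<open>f \<circ> \<gamma>\<close> are locally dominated, up to \<open>\<epsilon>\<close>, by
  those of \<open>s\<^sup>\<alpha> / \<alpha>\<close>, and a bisection argument makes this global.

  Conversely, composing with a norming functional (Hahn-Banach, from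
  a minimal sublinear functional, which is automatically linear) reduces the claim to the
  classical Cauchy inequality on the discs \<open>z + w \<zeta>\<close> of radius up to \<open>d(z)\<close>.\<close>

section \<open>Norming functionals\<close>

definition sublinear :: "('a::real_vector \<Rightarrow> real) \<Rightarrow> bool"
  where "sublinear p \<longleftrightarrow> (\<forall>x y. p (x + y) \<le> p x + p y) \<and> (\<forall>r x. 0 \<le> r \<longrightarrow> p (r *\<^sub>R x) = r * p x)"

lemma sublinear_add: "sublinear p \<Longrightarrow> p (x + y) \<le> p x + p y"
  and sublinear_scaleR: "sublinear p \<Longrightarrow> 0 \<le> r \<Longrightarrow> p (r *\<^sub>R x) = r * p x"
  by (auto simp: sublinear_def)

lemma sublinear_zero: "sublinear p \<Longrightarrow> p 0 = 0"
  using sublinear_scaleR[of p 0 0] by simp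

lemma sublinear_minus_le: "sublinear p \<Longrightarrow> - p (- x) \<le> p x"
  using sublinear_add[of p x "- x"] by (simp add: sublinear_zero)

text \<open>Applying the inequality with \<open>1 / r\<close> to \<open>r *\<^sub>R x\<close> gives
  the reverse one, so homogeneity needs only an upper bound and the value at 0.\<close>

lemma sublinearI:
  assumes "\<And>x y. p (x + y) \<le> p x + p y" and "\<And>r x. 0 < r \<Longrightarrow> p (r *\<^sub>R x) \<le> r * p x" and "p 0 = 0"
  shows "sublinear p"
  unfolding sublinear_def
proof (intro conjI allI impI)
  fix r :: real and x :: 'a assume "0 \<le> r"
  show "p (r *\<^sub>R x) = r * p x"
  proof (cases "r = 0")
    case False
    then have r: "0 < r" using \<open>0 \<le> r\<close> by simp
    have "p ((1 / r) *\<^sub>R (r *\<^sub>R x)) \<le> 1 / r * p (r *\<^sub>R x)" using r by (intro assms(2)) simp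
    then have "r * p x \<le> p (r *\<^sub>R x)" using r by (simp add: field_simps)
    then show ?thesis using assms(2)[OF r, of x] by simp
  qed (simp add: assms(3))
qed (rule assms(1))

text \<open>The largest sublinear functional below \<open>p\<close> that is at most \<open>- p y\<close> at \<open>- y\<close>.\<close>

definition sublinear_tilt :: "('a::real_vector \<Rightarrow> real) \<Rightarrow> 'a \<Rightarrow> 'a \<Rightarrow> real"
  where "sublinear_tilt p y x = (INF t\<in>{0..}. p (x + t *\<^sub>R y) - t * p y)"

text \<open>The infimum is finite: \<open>t * p y = p (t *\<^sub>R y) \<le> p (x + t *\<^sub>R y) +
  p (- x)\<close> makes \<open>- p (- x)\<close> a lower bound for every \<open>t\<close>.\<close>

lemma sublinear_tilt_le:
  assumes "sublinear p" and "0 \<le> t"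
  shows "sublinear_tilt p y x \<le> p (x + t *\<^sub>R y) - t * p y"
  unfolding sublinear_tilt_def
proof (rule cINF_lower)
  show "bdd_below ((\<lambda>t. p (x + t *\<^sub>R y) - t * p y) ` {0..})"
  proof (rule bdd_belowI2[where m = "- p (- x)"])
    fix t :: real assume "t \<in> {0..}"
    then show "- p (- x) \<le> p (x + t *\<^sub>R y) - t * p y"
      using sublinear_add[OF assms(1), of "x + t *\<^sub>R y" "- x"] sublinear_scaleR[OF assms(1), of t y] by simp
  qed
qed (use assms(2) in simp)

lemma le_sublinear_tilt:
  assumes "\<And>t. 0 \<le> t \<Longrightarrow> l \<le> p (x + t *\<^sub>R y) - t * p y"
  shows "l \<le> sublinear_tilt p y x"
  unfolding sublinear_tilt_def by (rule cINF_greatest) (use assms in auto)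

text \<open>Parameters \<open>t\<close> for \<open>x\<close> and \<open>t'\<close> for
  \<open>x'\<close> combine to \<open>t + t'\<close> for \<open>x + x'\<close>; the infima over
  \<open>t\<close> and \<open>t'\<close> are then taken one after the other. Homogeneity is the
  substitution of \<open>r * t\<close> for \<open>t\<close>.\<close>

lemma sublinear_sublinear_tilt:
  assumes p: "sublinear p"
  shows "sublinear (sublinear_tilt p y)"
proof (rule sublinearI)
  let ?q = "sublinear_tilt p y"
  fix x x' :: 'a
  have "?q (x + x') - (p (x' + t' *\<^sub>R y) - t' * p y) \<le> p (x + t *\<^sub>R y) - t * p y"
    if "0 \<le> t" "0 \<le> t'" for t t'
    using sublinear_tilt_le[OF p, of "t + t'" y "x + x'"] that
      sublinear_add[OF p, of "x + t *\<^sub>R y" "x' + t' *\<^sub>R y"]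
    by (simp add: algebra_simps)
  then have "?q (x + x') - (p (x' + t' *\<^sub>R y) - t' * p y) \<le> ?q x" if "0 \<le> t'" for t'
    using that by (intro le_sublinear_tilt)
  then have "?q (x + x') - ?q x \<le> ?q x'"
    by (intro le_sublinear_tilt) (force simp: algebra_simps)
  then show "?q (x + x') \<le> ?q x + ?q x'" by simp
next
  let ?q = "sublinear_tilt p y"
  fix r :: real and x :: 'a assume r: "0 < r"
  have "?q (r *\<^sub>R x) / r \<le> ?q x"
  proof (rule le_sublinear_tilt)
    fix t :: real assume t: "0 \<le> t"
    have "?q (r *\<^sub>R x) \<le> p (r *\<^sub>R (x + t *\<^sub>R y)) - (r * t) * p y"
      using sublinear_tilt_le[OF p, of "r * t" y "r *\<^sub>R x"] r t by (simp add: algebra_simps)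
    then show "?q (r *\<^sub>R x) / r \<le> p (x + t *\<^sub>R y) - t * p y"
      using r sublinear_scaleR[OF p, of r "x + t *\<^sub>R y"] by (simp add: field_simps)
  qed
  then show "?q (r *\<^sub>R x) \<le> r * ?q x" using r by (simp add: field_simps)
next
  show "sublinear_tilt p y 0 = 0"
  proof (rule antisym)
    show "sublinear_tilt p y 0 \<le> 0"
      using sublinear_tilt_le[OF p, of 0 y 0] sublinear_zero[OF p] by simp
    show "0 \<le> sublinear_tilt p y 0"
      by (rule le_sublinear_tilt) (simp add: sublinear_scaleR[OF p])
  qed
qed

text \<open>Finiteness follows from \<open>- p (- x) \<le> - q (- x) \<le> q x\<close>. Of two
  members of a chain the smaller one bounds the infimum at \<open>x + y\<close> by
  \<open>q x + q' y\<close>, even for different \<open>q\<close> and \<open>q'\<close>.\<close>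

lemma sublinear_INF_chain:
  fixes Q :: "('a::real_vector \<Rightarrow> real) set"
  assumes "Q \<noteq> {}" and sub: "\<And>q. q \<in> Q \<Longrightarrow> sublinear q" and le: "\<And>q. q \<in> Q \<Longrightarrow> q \<le> p"
    and chain: "\<And>q q'. q \<in> Q \<Longrightarrow> q' \<in> Q \<Longrightarrow> q \<le> q' \<or> q' \<le> q"
  shows "sublinear (\<lambda>x. INF q\<in>Q. q x)" and "\<And>q x. q \<in> Q \<Longrightarrow> (INF q\<in>Q. q x) \<le> q x"
proof -
  let ?i = "\<lambda>x. INF q\<in>Q. q x"
  have bdd: "bdd_below ((\<lambda>q. q x) ` Q)" for x
  proof (rule bdd_belowI2[where m = "- p (- x)"])
    fix q assume "q \<in> Q"
    then show "- p (- x) \<le> q x"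
      using sublinear_minus_le[OF sub, of q x] le_funD[OF le, of q "- x"] by linarith
  qed
  show lower: "?i x \<le> q x" if "q \<in> Q" for q x
    using that bdd by (intro cINF_lower)
  show "sublinear ?i"
  proof (rule sublinearI)
    fix x y
    have "?i (x + y) \<le> q x + q' y" if "q \<in> Q" "q' \<in> Q" for q q'
    proof -
      obtain r where r: "r \<in> Q" "r \<le> q" "r \<le> q'" using chain \<open>q \<in> Q\<close> \<open>q' \<in> Q\<close> by blast
      have "?i (x + y) \<le> r x + r y"
        using lower[OF r(1)] sublinear_add[OF sub[OF r(1)]] by (rule order_trans)
      then show ?thesis using r(2,3) by (smt (verit) le_funD)
    qed
    then have "?i (x + y) - q' y \<le> ?i x" if "q' \<in> Q" for q'
      using that by (intro cINF_greatest \<open>Q \<noteq> {}\<close>) (force simp: algebra_simps)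
    then have "?i (x + y) - ?i x \<le> ?i y"
      by (intro cINF_greatest \<open>Q \<noteq> {}\<close>) (force simp: algebra_simps)
    then show "?i (x + y) \<le> ?i x + ?i y" by simp
  next
    fix r :: real and x assume r: "0 < r"
    have "?i (r *\<^sub>R x) / r \<le> ?i x"
    proof (intro cINF_greatest \<open>Q \<noteq> {}\<close>)
      fix q assume "q \<in> Q"
      then show "?i (r *\<^sub>R x) / r \<le> q x"
        using lower[of q "r *\<^sub>R x"] sublinear_scaleR[OF sub, of q r x] r by (simp add: field_simps)
    qed
    then show "?i (r *\<^sub>R x) \<le> r * ?i x" using r by (simp add: field_simps)
  next
    have "(\<lambda>q. q 0) ` Q = {0}" using \<open>Q \<noteq> {}\<close> sub sublinear_zero by (force simp: image_def)
    then show "?i 0 = 0" by simp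
  qed
qed

text \<open>Zorn's lemma for the reversed pointwise order: a nonempty chain is bounded by its
  infimum, the empty chain by \<open>p\<close> itself.\<close>

lemma minimal_sublinear:
  fixes p :: "'a::real_vector \<Rightarrow> real"
  assumes "sublinear p"
  obtains q where "sublinear q" "q \<le> p" "\<And>q'. sublinear q' \<Longrightarrow> q' \<le> q \<Longrightarrow> q' = q"
proof -
  let ?A = "{q. sublinear q \<and> q \<le> p}"
  have "\<exists>m\<in>?A. \<forall>a\<in>?A. m \<ge> a \<longrightarrow> a = m"
  proof (rule predicate_Zorn)
    show "partial_order_on ?A (relation_of (\<lambda>q q'. q \<ge> q') ?A)"
      by (rule partial_order_on_relation_ofI) auto
  next
    fix Q assume "Q \<in> Chains (relation_of (\<lambda>q q'. q \<ge> q') ?A)"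
    then have Q: "\<And>q q'. q \<in> Q \<Longrightarrow> q' \<in> Q \<Longrightarrow> q \<le> q' \<or> q' \<le> q" "Q \<subseteq> ?A"
      by (auto simp: Chains_def relation_of_def)
    show "\<exists>u\<in>?A. \<forall>q\<in>Q. u \<le> q"
    proof (cases "Q = {}")
      case False
      let ?i = "\<lambda>x. INF q\<in>Q. q x"
      have i: "sublinear ?i" "\<And>q. q \<in> Q \<Longrightarrow> ?i \<le> q"
        using sublinear_INF_chain[OF False, of p] Q by (blast intro: le_funI)+
      moreover obtain q where "q \<in> Q" using False by blast
      ultimately have "?i \<le> p" using Q(2) order_trans[of ?i q p] by blast
      with i show ?thesis by blast
    qed (use assms in auto)
  qed
  then show thesis by (auto intro: that order_trans)
qed

text \<open>Each tilt of \<open>q\<close> lies below \<open>q\<close> (take \<open>t = 0\<close>),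
  hence equals \<open>q\<close> by minimality; \<open>t = 1\<close> then gives
  superadditivity.\<close>

lemma minimal_sublinear_linear:
  assumes q: "sublinear q" and min: "\<And>q'. sublinear q' \<Longrightarrow> q' \<le> q \<Longrightarrow> q' = q"
  shows "linear q"
proof
  have "sublinear_tilt q y = q" for y
  proof (rule min[OF sublinear_sublinear_tilt[OF q]])
    show "sublinear_tilt q y \<le> q"
      using sublinear_tilt_le[OF q, of 0 y] by (simp add: le_fun_def)
  qed
  then have "q x \<le> q (x + y) - q y" for x y
    using sublinear_tilt_le[OF q, of 1 y x] by simp
  then show add: "q (x + y) = q x + q y" for x y
    using sublinear_add[OF q, of x y] by (simp add: antisym algebra_simps)
  have minus: "q (- x) = - q x" for x
    using add[of x "- x"] sublinear_zero[OF q] by simp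
  show "q (r *\<^sub>R x) = r *\<^sub>R q x" for r x
  proof (cases "0 \<le> r")
    case False
    then show ?thesis using sublinear_scaleR[OF q, of "- r" x] minus[of "r *\<^sub>R x"] by simp
  qed (simp add: sublinear_scaleR[OF q])
qed

text \<open>The functional is a minimal one below the tilt of the norm in direction
  \<open>y\<close>: \<open>t = 0\<close> keeps it below the norm, and \<open>t = 1\<close> at
  \<open>- y\<close> forces the value \<open>norm y\<close> at \<open>y\<close>.\<close>

lemma real_norming_functional:
  fixes y :: "'a::real_normed_vector"
  obtains q :: "'a \<Rightarrow> real" where "linear q" "\<And>x. q x \<le> norm x" "q y = norm y"
proof -
  have n: "sublinear (norm :: 'a \<Rightarrow> real)" by (simp add: sublinear_def norm_triangle_ineq)
  obtain q where q: "sublinear q" "q \<le> sublinear_tilt norm y"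
      and min: "\<And>q'. sublinear q' \<Longrightarrow> q' \<le> q \<Longrightarrow> q' = q"
    using minimal_sublinear[OF sublinear_sublinear_tilt[OF n, of y]] by metis
  have lin: "linear q" using q(1) min by (rule minimal_sublinear_linear)
  have le: "q x \<le> norm x" for x
    using q(2) sublinear_tilt_le[OF n, of 0 y x] by (simp add: le_fun_def) (meson order_trans)
  have "q (- y) \<le> - norm y"
    using q(2) sublinear_tilt_le[OF n, of 1 y "- y"] by (simp add: le_fun_def) (meson order_trans)
  then have "q y = norm y" using le[of y] linear_neg[OF lin, of y] by simp
  with lin le show thesis by (rule that)
qed

section \<open>Passage to complex scalars\<close>

lemma scaleC_uminus_left: "(- a) *\<^sub>C x = - (a *\<^sub>C (x::'a::complex_normed_vector))"
  using scaleC_scaleC[of "-1" a x] scaleC_of_real[of "-1" "a *\<^sub>C x"] by simp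

lemma scaleC_zero_left [simp]: "0 *\<^sub>C x = (0::'a::complex_normed_vector)"
  using scaleC_of_real[of 0 x] by simp

lemma scaleC_one [simp]: "1 *\<^sub>C x = (x::'a::complex_normed_vector)"
  using scaleC_of_real[of 1 x] by simp

lemma bounded_linear_scaleC_left: "bounded_linear (\<lambda>a. a *\<^sub>C (x::'a::complex_normed_vector))"
proof (rule bounded_linear_intro)
  show "(r *\<^sub>R a) *\<^sub>C x = r *\<^sub>R (a *\<^sub>C x)" for r a
    by (simp add: scaleC_of_real[of r "a *\<^sub>C x", symmetric] scaleC_scaleC scaleR_conv_of_real)
  show "norm (a *\<^sub>C x) \<le> norm a * norm x" for a
    by (simp add: norm_scaleC)
qed (simp add: scaleC_add_left)

lemma complex_norming_functional:
  fixes y :: "'a::complex_normed_vector"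
  obtains \<phi> :: "'a \<Rightarrow> complex"
  where "bounded_linear \<phi>" "\<And>a x. \<phi> (a *\<^sub>C x) = a * \<phi> x" "\<And>x. cmod (\<phi> x) \<le> norm x" "norm y \<le> cmod (\<phi> y)"
proof -
  obtain q :: "'a \<Rightarrow> real" where lin: "linear q" and le: "\<And>x. q x \<le> norm x" and y: "q y = norm y"
    using real_norming_functional[of y] by metis
  \<comment> \<open>A complex linear functional is determined by its real part; this is the one with
    real part \<open>q\<close>.\<close>
  define \<phi> where "\<phi> x = Complex (q x) (- q (\<i> *\<^sub>C x))" for x
  have i_scaleR: "\<i> *\<^sub>C (r *\<^sub>R x) = r *\<^sub>R (\<i> *\<^sub>C x)" for r and x :: 'a
    by (simp add: scaleC_of_real[symmetric] scaleC_scaleC mult.commute)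
  have add: "\<phi> (x + x') = \<phi> x + \<phi> x'" for x x'
    by (simp add: \<phi>_def complex_eq_iff scaleC_add_right linear_add[OF lin])
  have real: "\<phi> (r *\<^sub>R x) = r *\<^sub>R \<phi> x" for r x
    by (simp add: \<phi>_def complex_eq_iff i_scaleR linear_scale[OF lin])
  have i: "\<phi> (\<i> *\<^sub>C x) = \<i> * \<phi> x" for x
    by (simp add: \<phi>_def complex_eq_iff scaleC_scaleC scaleC_uminus_left linear_neg[OF lin])
  have scale: "\<phi> (a *\<^sub>C x) = a * \<phi> x" for a x
  proof -
    have "a *\<^sub>C x = Re a *\<^sub>R x + Im a *\<^sub>R (\<i> *\<^sub>C x)"
      by (subst complex_eq) (simp add: scaleC_add_left scaleC_of_real[symmetric] scaleC_scaleC mult.commute)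
    then have "\<phi> (a *\<^sub>C x) = Re a *\<^sub>R \<phi> x + Im a *\<^sub>R (\<i> * \<phi> x)" by (simp add: add real i)
    also have "\<dots> = a * \<phi> x" by (simp add: complex_eq_iff)
    finally show ?thesis .
  qed
  have bound: "cmod (\<phi> x) \<le> norm x" for x
  proof -
    \<comment> \<open>Multiplication by \<open>u\<close> rotates \<open>\<phi> x\<close> onto its
      modulus, so the bound on the real part suffices. If \<open>\<phi> x = 0\<close> then
      \<open>u = 0\<close>, so its modulus is only at most 1.\<close>
    define u where "u = cnj (sgn (\<phi> x))"
    have "\<phi> 0 = 0" using real[of 0 0] by simp
    have "cmod u \<le> 1" by (simp add: u_def norm_sgn)
    have "\<phi> (u *\<^sub>C x) = complex_of_real (cmod (\<phi> x))"
      using \<open>\<phi> 0 = 0\<close> by (cases "\<phi> x = 0")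
        (simp_all add: scale u_def sgn_eq complex_norm_square[symmetric] power2_eq_square mult.commute)
    then have "cmod (\<phi> x) = Re (\<phi> (u *\<^sub>C x))" by simp
    also have "\<dots> \<le> norm (u *\<^sub>C x)" by (simp add: \<phi>_def le)
    also have "\<dots> \<le> norm x"
      using mult_right_mono[OF \<open>cmod u \<le> 1\<close>, of "norm x"] by (simp add: norm_scaleC)
    finally show ?thesis .
  qed
  have "bounded_linear \<phi>"
    by (rule bounded_linear_intro[where K = 1]) (simp_all add: add real bound)
  moreover have "norm y \<le> cmod (\<phi> y)"
    using complex_Re_le_cmod[of "\<phi> y"] by (simp add: \<phi>_def y)
  ultimately show thesis using scale bound by (intro that)
qed

section \<open>The Cauchy inequality\<close>

text \<open>An open set is disjoint from its frontier, which is closed. The frontier must be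
  nonempty because \<open>infdist\<close> to the empty set is 0.\<close>

lemma infdist_frontier_pos:
  fixes D :: "'a::real_normed_vector set"
  assumes "open D" "frontier D \<noteq> {}" "z \<in> D"
  shows "0 < infdist z (frontier D)"
  using assms in_closed_iff_infdist_zero[of "frontier D" z] infdist_nonneg[of z "frontier D"]
  by (auto simp: frontier_def interior_open order_less_le)

text \<open>Balls are connected, so one that starts in \<open>D\<close> and leaves it would meet the
  frontier at a distance less than the infimum.\<close>

lemma ball_infdist_frontier_subset:
  fixes D :: "'a::real_normed_vector set"
  assumes "z \<in> D" "0 < infdist z (frontier D)"
  shows "ball z (infdist z (frontier D)) \<subseteq> D"
proof (rule ccontr)
  assume "\<not> ball z (infdist z (frontier D)) \<subseteq> D"
  then obtain x where "x \<in> ball z (infdist z (frontier D)) \<inter> frontier D"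
    using connected_Int_frontier[OF connected_ball, of z "infdist z (frontier D)" D] assms
    by (metis Diff_eq_empty_iff disjoint_iff centre_in_ball equals0I)
  then show False using infdist_le[of x "frontier D" z] by simp
qed

text \<open>Uniqueness of the derivative transfers complex linearity from the existential witness to
  \<open>frechet_derivative\<close>.\<close>

lemma analytic_mapping_on_derivative:
  assumes "analytic_mapping_on f D" "z \<in> D"
  shows "(f has_derivative frechet_derivative f (at z)) (at z)"
    and "frechet_derivative f (at z) (a *\<^sub>C \<zeta>) = a *\<^sub>C frechet_derivative f (at z) \<zeta>"
proof -
  obtain L where L: "(f has_derivative L) (at z)" "\<And>a \<zeta>. L (a *\<^sub>C \<zeta>) = a *\<^sub>C L \<zeta>"
    using assms by (auto simp: analytic_mapping_on_def complex_frechet_differentiable_def)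
  have "frechet_derivative f (at z) = L" using L(1) by (metis frechet_derivative_at)
  with L show "(f has_derivative frechet_derivative f (at z)) (at z)"
    and "frechet_derivative f (at z) (a *\<^sub>C \<zeta>) = a *\<^sub>C frechet_derivative f (at z) \<zeta>" by simp_all
qed

lemma analytic_mapping_Cauchy_inequality:
  fixes f :: "'a::complex_normed_vector \<Rightarrow> 'b::complex_normed_vector"
  assumes f: "analytic_mapping_on f D" and r: "0 < r" and D: "cball z r \<subseteq> D"
    and B: "\<And>w. norm (w - z) = r \<Longrightarrow> norm (f w - f z) \<le> B"
  shows "norm (frechet_derivative f (at z) \<zeta>) \<le> B / r * norm \<zeta>"
proof (cases "\<zeta> = 0")
  case True
  have "z \<in> D" using D r by auto
  then show ?thesis
    using True linear_0[OF has_derivative_linear[OF analytic_mapping_on_derivative(1)[OF f]]] by simp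
next
  case False
  define L where "L w = frechet_derivative f (at w)" for w
  obtain \<phi> :: "'b \<Rightarrow> complex" where \<phi>: "bounded_linear \<phi>" "\<And>a x. \<phi> (a *\<^sub>C x) = a * \<phi> x"
      "\<And>x. cmod (\<phi> x) \<le> norm x" "norm (L z \<zeta>) \<le> cmod (\<phi> (L z \<zeta>))"
    using complex_norming_functional[of "L z \<zeta>"] by metis
  \<comment> \<open>Subtracting \<open>f z\<close> leaves the derivative unchanged and lets the
    oscillation bound \<open>B\<close> control \<open>h\<close>. The functional norms
    \<open>L z \<zeta>\<close>, so nothing is lost on passing to scalars.\<close>
  define h where "h w = \<phi> (f (z + w *\<^sub>C \<zeta>) - f z)" for w
  \<comment> \<open>With this radius, \<open>z + w *\<^sub>C \<zeta>\<close> runs over points at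
    distance \<open>r\<close> from \<open>z\<close> when \<open>w\<close> has modulus
    \<open>\<rho>\<close>.\<close>
  define \<rho> where "\<rho> = r / norm \<zeta>"
  have "0 < \<rho>" using r False by (simp add: \<rho>_def)
  have deriv: "(h has_field_derivative \<phi> (L (z + w *\<^sub>C \<zeta>) \<zeta>)) (at w)" if "w \<in> cball 0 \<rho>" for w
  proof -
    have "z + w *\<^sub>C \<zeta> \<in> D"
      using that D False by (intro subsetD[OF D]) (simp add: \<rho>_def dist_norm norm_scaleC field_simps)
    note df = analytic_mapping_on_derivative[OF f this, folded L_def]
    have "((\<lambda>w. z + w *\<^sub>C \<zeta>) has_derivative (\<lambda>a. a *\<^sub>C \<zeta>)) (at w)"
      by (rule derivative_eq_intros bounded_linear.has_derivative[OF bounded_linear_scaleC_left] refl | simp)+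
    from has_derivative_compose[OF this df(1)]
    have "((\<lambda>w. f (z + w *\<^sub>C \<zeta>) - f z) has_derivative (\<lambda>a. a *\<^sub>C L (z + w *\<^sub>C \<zeta>) \<zeta>)) (at w)"
      by (auto intro!: derivative_eq_intros simp: df(2))
    from bounded_linear.has_derivative[OF \<phi>(1) this] show ?thesis
      unfolding has_field_derivative_def h_def \<phi>(2) by (simp add: mult.commute[of _ "\<phi> _"])
  qed
  have "h holomorphic_on cball 0 \<rho>"
    unfolding holomorphic_on_def field_differentiable_def using deriv has_field_derivative_at_within by blast
  moreover have "cmod (h w) \<le> B" if "cmod (0 - w) = \<rho>" for w
  proof -
    have "norm (f (z + w *\<^sub>C \<zeta>) - f z) \<le> B"
      using that False by (intro B) (simp add: norm_scaleC \<rho>_def)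
    then show ?thesis unfolding h_def using \<phi>(3) order_trans by blast
  qed
  ultimately have "cmod ((deriv ^^ 1) h 0) \<le> fact 1 * B / \<rho> ^ 1"
    using \<open>0 < \<rho>\<close>
    by (intro Cauchy_inequality)
      (auto intro: holomorphic_on_subset holomorphic_on_imp_continuous_on simp: dist_norm)
  moreover have "deriv h 0 = \<phi> (L z \<zeta>)"
    using DERIV_imp_deriv[OF deriv[of 0]] \<open>0 < \<rho>\<close> by simp
  ultimately show ?thesis using \<phi>(4) by (simp add: \<rho>_def L_def)
qed

section \<open>Increments along curves\<close>

text \<open>The estimate passes from two adjacent intervals to their union by the triangle
  inequality, so bisection reduces it to short intervals around a point.\<close>

lemma norm_increment_le_of_local:
  fixes F :: "real \<Rightarrow> 'a::real_normed_vector" and \<phi> :: "real \<Rightarrow> real"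
  assumes "a \<le> b"
    and local: "\<And>s. s \<in> {a..b} \<Longrightarrow> \<exists>\<delta>>0. \<forall>u v. a \<le> u \<and> u \<le> s \<and> s \<le> v \<and> v \<le> b \<and> v - u < \<delta> \<longrightarrow>
      norm (F v - F u) \<le> \<phi> v - \<phi> u"
  shows "norm (F b - F a) \<le> \<phi> b - \<phi> a"
proof -
  \<comment> \<open>The bounds are built into the predicate because the bisection principle also
    considers intervals reaching outside \<open>{a..b}\<close>.\<close>
  have "a \<le> a \<and> b \<le> b \<longrightarrow> norm (F b - F a) \<le> \<phi> b - \<phi> a"
  proof (rule Bolzano[OF \<open>a \<le> b\<close>, where P = "\<lambda>u v. a \<le> u \<and> v \<le> b \<longrightarrow> norm (F v - F u) \<le> \<phi> v - \<phi> u"])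
    fix u v w
    assume *: "a \<le> u \<and> v \<le> b \<longrightarrow> norm (F v - F u) \<le> \<phi> v - \<phi> u"
      "a \<le> v \<and> w \<le> b \<longrightarrow> norm (F w - F v) \<le> \<phi> w - \<phi> v" "u \<le> v" "v \<le> w"
    show "a \<le> u \<and> w \<le> b \<longrightarrow> norm (F w - F u) \<le> \<phi> w - \<phi> u"
      using * norm_triangle_ineq[of "F w - F v" "F v - F u"] by auto
  next
    fix s assume "a \<le> s" "s \<le> b"
    then show "\<exists>d>0. \<forall>u v. u \<le> s \<and> s \<le> v \<and> v - u < d \<longrightarrow>
        (a \<le> u \<and> v \<le> b \<longrightarrow> norm (F v - F u) \<le> \<phi> v - \<phi> u)"
      using local[of s] by (meson atLeastAtMost_iff)
  qed
  then show ?thesis by simp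
qed

text \<open>By concavity the slope of the chord is at least that of the tangent at the right end. It
  is Young's inequality for \<open>p\<close> and \<open>q\<close> with weights \<alpha> and 1 -
  \<alpha>, multiplied by \<open>q powr (\<alpha> - 1)\<close>.\<close>

lemma powr_increment_ge:
  fixes p q \<alpha> :: real
  assumes "0 < \<alpha>" "\<alpha> < 1" "0 \<le> p" "p \<le> q"
  shows "\<alpha> * q powr (\<alpha> - 1) * (q - p) \<le> q powr \<alpha> - p powr \<alpha>"
proof (cases "q = 0")
  case False
  then have q: "0 < q" using assms by simp
  have "p powr \<alpha> * q powr (1 - \<alpha>) \<le> \<alpha> * p + (1 - \<alpha>) * q"
    using assms q by (cases "p = 0") (auto intro!: Youngs_inequality_0)
  then have "p powr \<alpha> * q powr (1 - \<alpha>) * q powr (\<alpha> - 1) \<le> (\<alpha> * p + (1 - \<alpha>) * q) * q powr (\<alpha> - 1)"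
    by (intro mult_right_mono) auto
  moreover have "q powr (1 - \<alpha>) * q powr (\<alpha> - 1) = 1" "q * q powr (\<alpha> - 1) = q powr \<alpha>"
    using q by (simp_all add: powr_add[symmetric] powr_mult_base)
  ultimately show ?thesis by (simp add: algebra_simps)
qed (use assms in auto)

text \<open>The function \<open>A\<close> plays the role of arc length along \<open>g\<close>; it need not be continuous.\<close>

lemma holder_along_curve:
  fixes g :: "real \<Rightarrow> 'a::real_normed_vector" and f :: "'a \<Rightarrow> 'b::real_normed_vector"
    and d :: "'a \<Rightarrow> real"
  assumes \<alpha>: "0 < \<alpha>" "\<alpha> < 1" and c: "0 < c" and C: "0 \<le> C" and "a \<le> b"
    and g: "continuous_on {a..b} g"
    and f: "\<And>s. s \<in> {a..b} \<Longrightarrow> f differentiable (at (g s))"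
    and d: "continuous_on (g ` {a..b}) d" "\<And>s. s \<in> {a..b} \<Longrightarrow> 0 < d (g s)"
    and bound: "\<And>s. s \<in> {a..b} \<Longrightarrow> onorm (frechet_derivative f (at (g s))) \<le> C * d (g s) powr (\<alpha> - 1)"
    and A0: "0 \<le> A a"
    and A: "\<And>u v. a \<le> u \<Longrightarrow> u \<le> v \<Longrightarrow> v \<le> b \<Longrightarrow> norm (g v - g u) \<le> A v - A u"
    and Ad: "\<And>s. s \<in> {a..b} \<Longrightarrow> A s \<le> c * d (g s)"
  shows "norm (f (g b) - f (g a)) \<le> C * c powr (1 - \<alpha>) / \<alpha> * (A b powr \<alpha> - A a powr \<alpha>)"
proof -
  define N where "N s = C * d (g s) powr (\<alpha> - 1)" for s
  \<comment> \<open>The power of \<open>c\<close> comes from replacing \<open>d\<close> by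
    \<open>A / c\<close>, the factor 1 / \<alpha> from integrating the power \<alpha> - 1.\<close>
  define K where "K = C * c powr (1 - \<alpha>) / \<alpha>"
  have N_cont: "continuous_on {a..b} N"
    unfolding N_def using g d(2)
    by (intro continuous_intros continuous_on_compose2[OF d(1)]) force+
  have mono: "A u \<le> A v" if "a \<le> u" "u \<le> v" "v \<le> b" for u v
    using A[OF that] norm_ge_zero[of "g v - g u"] by linarith
  \<comment> \<open>The weight is taken at the right end, where \<open>A v > 0\<close> unless the
    increment vanishes. As \<alpha> - 1 is negative, \<open>A v / c \<le> d (g v)\<close> bounds
    \<open>N v\<close> from above, and concavity applies.\<close>
  have step: "N v * (A v - A u) \<le> K * (A v powr \<alpha> - A u powr \<alpha>)" if "a \<le> u" "u \<le> v" "v \<le> b" for u v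
  proof (cases "A v = A u")
    case False
    have u: "0 \<le> A u" "A u \<le> A v" using mono[of a u] mono[of u v] that A0 by simp_all
    then have v: "0 < A v" using False by simp
    have "N v \<le> C * (A v / c) powr (\<alpha> - 1)"
      unfolding N_def using Ad[of v] that v c \<alpha> C
      by (intro mult_left_mono powr_mono2') (simp_all add: field_simps)
    also have "\<dots> = K * (\<alpha> * A v powr (\<alpha> - 1))"
      using v c \<alpha> powr_minus[of c "1 - \<alpha>"] by (simp add: K_def powr_divide field_simps)
    finally have "N v * (A v - A u) \<le> K * (\<alpha> * A v powr (\<alpha> - 1)) * (A v - A u)"
      using u by (intro mult_right_mono) auto
    also have "\<dots> = K * (\<alpha> * A v powr (\<alpha> - 1) * (A v - A u))" by simp
    also have "\<dots> \<le> K * (A v powr \<alpha> - A u powr \<alpha>)"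
      using powr_increment_ge[OF \<alpha> u] C \<alpha> by (intro mult_left_mono) (simp_all add: K_def)
    finally show ?thesis .
  qed simp
  have approx: "norm (f (g b) - f (g a)) \<le> K * (A b powr \<alpha> - A a powr \<alpha>) + e * (2 * (A b - A a))"
    if e: "0 < e" for e
  proof -
    \<comment> \<open>One \<open>e\<close> pays for the differentiability error at \<open>s\<close>,
      the other for replacing \<open>N s\<close> by \<open>N v\<close>.\<close>
    define \<phi> where "\<phi> t = K * A t powr \<alpha> + 2 * e * A t" for t
    have "norm (f (g b) - f (g a)) \<le> \<phi> b - \<phi> a"
    proof (rule norm_increment_le_of_local[OF \<open>a \<le> b\<close>, where F = "\<lambda>t. f (g t)"])
      fix s assume s: "s \<in> {a..b}"
      define L where "L = frechet_derivative f (at (g s))"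
      have L: "(f has_derivative L) (at (g s))"
        using f[OF s] by (simp add: L_def frechet_derivative_works)
      then obtain \<eta> where \<eta>: "0 < \<eta>"
          "\<And>y. norm (y - g s) < \<eta> \<Longrightarrow> norm (f y - f (g s) - L (y - g s)) \<le> e * norm (y - g s)"
        using e unfolding has_derivative_at_alt by blast
      obtain \<delta>1 where \<delta>1: "0 < \<delta>1" "\<And>t. t \<in> {a..b} \<Longrightarrow> dist t s < \<delta>1 \<Longrightarrow> dist (g t) (g s) < \<eta>"
        using g s \<eta>(1) unfolding continuous_on_iff by metis
      obtain \<delta>2 where \<delta>2: "0 < \<delta>2" "\<And>t. t \<in> {a..b} \<Longrightarrow> dist t s < \<delta>2 \<Longrightarrow> dist (N t) (N s) < e"
        using N_cont s e unfolding continuous_on_iff by metis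
      have near: "norm (f (g t) - f (g s)) \<le> (N s + e) * norm (g t - g s)"
        if "t \<in> {a..b}" "dist t s < \<delta>1" for t
      proof -
        have "norm (L (g t - g s)) \<le> N s * norm (g t - g s)"
          using onorm[OF has_derivative_bounded_linear[OF L], of "g t - g s"]
            mult_right_mono[OF bound[OF s], of "norm (g t - g s)"]
          by (simp add: N_def L_def)
        moreover have "norm (f (g t) - f (g s) - L (g t - g s)) \<le> e * norm (g t - g s)"
          using \<delta>1(2)[OF that] by (intro \<eta>(2)) (simp add: dist_norm)
        ultimately show ?thesis
          using norm_triangle_ineq[of "f (g t) - f (g s) - L (g t - g s)" "L (g t - g s)"]
          by (simp add: algebra_simps)
      qed
      have "norm (f (g v) - f (g u)) \<le> \<phi> v - \<phi> u"
        if uv: "a \<le> u" "u \<le> s" "s \<le> v" "v \<le> b" "v - u < min \<delta>1 \<delta>2" for u v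
      proof -
        have "0 \<le> N s" using C by (simp add: N_def)
        \<comment> \<open>The increment is split at \<open>s\<close> because differentiability there
          only controls increments from \<open>s\<close>.\<close>
        have "norm (f (g v) - f (g u)) \<le> norm (f (g v) - f (g s)) + norm (f (g u) - f (g s))"
          using norm_triangle_ineq4[of "f (g v) - f (g s)" "f (g u) - f (g s)"] by simp
        also have "\<dots> \<le> (N s + e) * norm (g v - g s) + (N s + e) * norm (g s - g u)"
          using near[of v] near[of u] uv by (simp add: dist_real_def norm_minus_commute[of "g s"])
        also have "\<dots> \<le> (N s + e) * (A v - A s) + (N s + e) * (A s - A u)"
          using \<open>0 \<le> N s\<close> e uv by (intro add_mono mult_left_mono A) auto
        also have "\<dots> = (N s + e) * (A v - A u)" by (simp add: algebra_simps)
        also have "\<dots> \<le> (N v + 2 * e) * (A v - A u)"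
          using \<delta>2(2)[of v] uv mono[of u v] by (intro mult_right_mono) (auto simp: dist_real_def)
        also have "\<dots> \<le> \<phi> v - \<phi> u"
          using step[of u v] uv by (simp add: \<phi>_def algebra_simps)
        finally show ?thesis .
      qed
      then show "\<exists>\<delta>>0. \<forall>u v. a \<le> u \<and> u \<le> s \<and> s \<le> v \<and> v \<le> b \<and> v - u < \<delta> \<longrightarrow>
          norm (f (g v) - f (g u)) \<le> \<phi> v - \<phi> u"
        using \<delta>1(1) \<delta>2(1) by (intro exI[of _ "min \<delta>1 \<delta>2"]) simp
    qed
    then show ?thesis by (simp add: \<phi>_def algebra_simps)
  qed
  have "norm (f (g b) - f (g a)) \<le> K * (A b powr \<alpha> - A a powr \<alpha>)"
  proof (rule tendsto_lowerbound)
    show "((\<lambda>e. K * (A b powr \<alpha> - A a powr \<alpha>) + e * (2 * (A b - A a))) \<longlongrightarrow>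
        K * (A b powr \<alpha> - A a powr \<alpha>)) (at_right 0)"
      by (auto intro!: tendsto_eq_intros)
    show "\<forall>\<^sub>F e in at_right 0.
        norm (f (g b) - f (g a)) \<le> K * (A b powr \<alpha> - A a powr \<alpha>) + e * (2 * (A b - A a))"
      using approx by (auto intro: eventually_at_rightI[of 0 1])
  qed simp
  then show ?thesis by (simp add: K_def)
qed

section \<open>Length of curves\<close>

lemma curve_length_upper:
  assumes "t 0 = a" "t n = b" "\<And>i. i < n \<Longrightarrow> t i \<le> t (Suc i)"
  shows "ereal (\<Sum>i<n. norm (g (t (Suc i)) - g (t i))) \<le> curve_length g a b"
  unfolding curve_length_def
  by (rule SUP_upper2[where i = "(n, t)"]) (use assms in auto)

lemma curve_length_least:
  assumes "\<And>n t. t 0 = a \<Longrightarrow> t n = b \<Longrightarrow> (\<And>i. i < n \<Longrightarrow> t i \<le> t (Suc i)) \<Longrightarrow>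
    ereal (\<Sum>i<n. norm (g (t (Suc i)) - g (t i))) \<le> l"
  shows "curve_length g a b \<le> l"
  unfolding curve_length_def by (rule SUP_least) (use assms in auto)

lemma norm_le_curve_length:
  assumes "a \<le> b"
  shows "ereal (norm (g b - g a)) \<le> curve_length g a b"
  using curve_length_upper[of "\<lambda>i. if i = 0 then a else b" a 1 b g] assms by simp

text \<open>The order of the endpoints matters: for \<open>b < a\<close> there is no partition, and
  the empty supremum is minus infinity.\<close>

lemma curve_length_nonneg: "a \<le> b \<Longrightarrow> 0 \<le> curve_length g a b"
  using norm_le_curve_length[of a b g] order_trans[of 0 "ereal (norm (g b - g a))"] by simp

text \<open>Any partition ending at \<open>u\<close> extends by the point \<open>v\<close>. The
  finite last term is moved to the right so that the supremum can be bounded partition by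
  partition.\<close>

lemma curve_length_append:
  assumes "u \<le> v"
  shows "curve_length g a u + ereal (norm (g v - g u)) \<le> curve_length g a v"
proof -
  have "curve_length g a u \<le> curve_length g a v - ereal (norm (g v - g u))"
  proof (rule curve_length_least)
    fix n t assume t: "t 0 = a" "t n = u" "\<And>i. i < n \<Longrightarrow> t i \<le> t (Suc i)"
    have "ereal (\<Sum>i<Suc n. norm (g ((t(Suc n := v)) (Suc i)) - g ((t(Suc n := v)) i)))
        \<le> curve_length g a v"
      by (rule curve_length_upper) (use t assms in \<open>auto simp: less_Suc_eq\<close>)
    then show "ereal (\<Sum>i<n. norm (g (t (Suc i)) - g (t i))) \<le> curve_length g a v - ereal (norm (g v - g u))"
      by (simp add: t ereal_le_minus)
  qed
  then show ?thesis by (simp add: ereal_le_minus)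
qed

lemma curve_length_prepend:
  assumes "u \<le> v"
  shows "curve_length g v b + ereal (norm (g v - g u)) \<le> curve_length g u b"
proof -
  have "curve_length g v b \<le> curve_length g u b - ereal (norm (g v - g u))"
  proof (rule curve_length_least)
    fix n t assume t: "t 0 = v" "t n = b" "\<And>i. i < n \<Longrightarrow> t i \<le> t (Suc i)"
    have "ereal (\<Sum>i<Suc n. norm (g (case_nat u t (Suc i)) - g (case_nat u t i))) \<le> curve_length g u b"
      by (rule curve_length_upper) (use t assms in \<open>auto split: nat.split\<close>)
    then show "ereal (\<Sum>i<n. norm (g (t (Suc i)) - g (t i))) \<le> curve_length g u b - ereal (norm (g v - g u))"
      by (subst (asm) sum.lessThan_Suc_shift) (simp add: t ereal_le_minus add.commute)
  qed
  then show ?thesis by (simp add: ereal_le_minus)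
qed

text \<open>Finite total length makes both partial lengths real. \<open>A\<close> and
  \<open>B\<close> measure from the two ends, so each can serve as the length function on its half
  of the arc.\<close>

lemma curve_length_real:
  assumes "curve_length g 0 1 < \<infinity>"
  obtains A B :: "real \<Rightarrow> real" where
    "\<And>s. s \<in> {0..1} \<Longrightarrow> curve_length g 0 s = ereal (A s)"
    "\<And>s. s \<in> {0..1} \<Longrightarrow> curve_length g s 1 = ereal (B s)"
    "\<And>s. s \<in> {0..1} \<Longrightarrow> 0 \<le> A s \<and> 0 \<le> B s"
    "\<And>u v. 0 \<le> u \<Longrightarrow> u \<le> v \<Longrightarrow> v \<le> 1 \<Longrightarrow> norm (g v - g u) \<le> A v - A u"
    "\<And>u v. 0 \<le> u \<Longrightarrow> u \<le> v \<Longrightarrow> v \<le> 1 \<Longrightarrow> norm (g v - g u) \<le> B u - B v"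
proof -
  define A where "A s = real_of_ereal (curve_length g 0 s)" for s
  define B where "B s = real_of_ereal (curve_length g s 1)" for s
  have le: "curve_length g 0 s \<le> curve_length g 0 1" "curve_length g s 1 \<le> curve_length g 0 1"
    if "s \<in> {0..1}" for s
    using that curve_length_append[of s 1 g 0] curve_length_prepend[of 0 s g 1]
    by (auto intro: order_trans[rotated] simp: ereal_le_add_self)
  have A: "curve_length g 0 s = ereal (A s)" and B: "curve_length g s 1 = ereal (B s)"
    if "s \<in> {0..1}" for s
    using le[OF that] assms curve_length_nonneg[of 0 s g] curve_length_nonneg[of s 1 g] that
    unfolding A_def B_def by (auto simp: ereal_real)
  show thesis
  proof (rule that[of A B])
    show "0 \<le> A s \<and> 0 \<le> B s" if "s \<in> {0..1}" for s
      using curve_length_nonneg[of 0 s g] curve_length_nonneg[of s 1 g] A[OF that] B[OF that] that by simp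
    show "norm (g v - g u) \<le> A v - A u" if "0 \<le> u" "u \<le> v" "v \<le> 1" for u v
      using curve_length_append[of u v g 0] A[of u] A[of v] that by simp
    show "norm (g v - g u) \<le> B u - B v" if "0 \<le> u" "u \<le> v" "v \<le> 1" for u v
      using curve_length_prepend[of u v g 1] B[of u] B[of v] that by simp
  qed (fact A B)+
qed

section \<open>Hoelder estimate along the arcs of a uniform domain\<close>

lemma holder_of_uniform_arc:
  fixes g :: "real \<Rightarrow> 'a::real_normed_vector" and f :: "'a \<Rightarrow> 'b::real_normed_vector"
    and d :: "'a \<Rightarrow> real"
  assumes \<alpha>: "0 < \<alpha>" "\<alpha> < 1" and c: "0 < c" and C: "0 \<le> C"
    and g: "path g" and f: "\<And>z. z \<in> path_image g \<Longrightarrow> f differentiable (at z)"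
    and d: "continuous_on (path_image g) d" "\<And>z. z \<in> path_image g \<Longrightarrow> 0 < d z"
    and bound: "\<And>z. z \<in> path_image g \<Longrightarrow> onorm (frechet_derivative f (at z)) \<le> C * d z powr (\<alpha> - 1)"
    and len: "curve_length g 0 1 \<le> ereal l"
    and min: "\<And>s. s \<in> {0..1} \<Longrightarrow> min (curve_length g 0 s) (curve_length g s 1) \<le> ereal (c * d (g s))"
  shows "norm (f (pathfinish g) - f (pathstart g)) \<le> 2 * C * c powr (1 - \<alpha>) / \<alpha> * l powr \<alpha>"
proof -
  obtain A B where A: "\<And>s. s \<in> {0..1} \<Longrightarrow> curve_length g 0 s = ereal (A s)"
    and B: "\<And>s. s \<in> {0..1} \<Longrightarrow> curve_length g s 1 = ereal (B s)"
    and nonneg: "\<And>s. s \<in> {0..1} \<Longrightarrow> 0 \<le> A s \<and> 0 \<le> B s"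
    and incA: "\<And>u v. 0 \<le> u \<Longrightarrow> u \<le> v \<Longrightarrow> v \<le> 1 \<Longrightarrow> norm (g v - g u) \<le> A v - A u"
    and incB: "\<And>u v. 0 \<le> u \<Longrightarrow> u \<le> v \<Longrightarrow> v \<le> 1 \<Longrightarrow> norm (g v - g u) \<le> B u - B v"
  proof -
    have "curve_length g 0 1 < \<infinity>" using len by (rule le_less_trans) simp
    then show thesis by (rule curve_length_real) (rule that)
  qed
  have monoA: "A u \<le> A v" and monoB: "B v \<le> B u" if "0 \<le> u" "u \<le> v" "v \<le> 1" for u v
    using incA[OF that] incB[OF that] norm_ge_zero[of "g v - g u"] by linarith+
  define Q where "Q = C * c powr (1 - \<alpha>) / \<alpha> * l powr \<alpha>"
  have Q: "C * c powr (1 - \<alpha>) / \<alpha> * (x powr \<alpha> - y powr \<alpha>) \<le> Q" if "0 \<le> x" "x \<le> l" for x y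
  proof -
    have "x powr \<alpha> - y powr \<alpha> \<le> l powr \<alpha>"
      using powr_mono2[of \<alpha> x l] that \<alpha> powr_ge_zero[of y \<alpha>] by linarith
    then show ?thesis unfolding Q_def using C \<alpha> by (intro mult_left_mono) auto
  qed
  have l: "A s \<le> l" "B s \<le> l" if "s \<in> {0..1}" for s
    using monoA[of s 1] monoB[of 0 s] that len A[of 1] B[of 0] by auto
  have minAB: "min (A s) (B s) \<le> c * d (g s)" if "s \<in> {0..1}" for s
    using min[OF that] by (simp add: A[OF that] B[OF that] min_def split: if_splits)
  have img: "g s \<in> path_image g" if "s \<in> {0..1}" for s
    using that by (simp add: path_image_def)
  have cont: "continuous_on {0..1} g" using g by (simp add: path_def)
  have left: "norm (f (g s) - f (g 0)) \<le> Q" if s: "s \<in> {0..1}" "A s \<le> B s" for s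
  proof -
    have "norm (f (g s) - f (g 0)) \<le> C * c powr (1 - \<alpha>) / \<alpha> * (A s powr \<alpha> - A 0 powr \<alpha>)"
    proof (rule holder_along_curve[OF \<alpha> c C, where d = d])
      \<comment> \<open>For \<open>t \<le> s\<close>, monotonicity gives
        \<open>A t \<le> A s \<le> B s \<le> B t\<close>, so the minimum in the arc condition is
        \<open>A t\<close>.\<close>
      show "A t \<le> c * d (g t)" if "t \<in> {0..s}" for t
        using minAB[of t] monoA[of t s] monoB[of t s] s that by simp
      show "continuous_on {0..s} g" using s by (intro continuous_on_subset[OF cont]) auto
      show "continuous_on (g ` {0..s}) d" using s by (intro continuous_on_subset[OF d(1)]) (auto intro: img)
    qed (use s nonneg in \<open>auto intro!: f d bound img incA\<close>)
    also have "\<dots> \<le> Q" using s nonneg l by (intro Q) auto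
    finally show ?thesis .
  qed
  have right: "norm (f (g 1) - f (g s)) \<le> Q" if s: "s \<in> {0..1}" "B s \<le> A s" for s
  proof -
    \<comment> \<open>The estimate is applied to the reversed curve, on which \<open>B\<close>
      increases; the unsimplified arguments match its endpoints \<open>1 - s\<close> and 0.\<close>
    have "norm (f (g (1 - (1 - s))) - f (g (1 - 0)))
        \<le> C * c powr (1 - \<alpha>) / \<alpha> * (B (1 - (1 - s)) powr \<alpha> - B (1 - 0) powr \<alpha>)"
    proof (rule holder_along_curve[OF \<alpha> c C, where d = d and g = "\<lambda>t. g (1 - t)" and A = "\<lambda>t. B (1 - t)"])
      show "B (1 - t) \<le> c * d (g (1 - t))" if "t \<in> {0..1 - s}" for t
        using minAB[of "1 - t"] monoA[of s "1 - t"] monoB[of s "1 - t"] s that by simp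
      show "continuous_on {0..1 - s} (\<lambda>t. g (1 - t))"
        using s by (intro continuous_on_compose2[OF cont] continuous_intros) auto
      show "continuous_on ((\<lambda>t. g (1 - t)) ` {0..1 - s}) d"
        using s by (intro continuous_on_subset[OF d(1)]) (auto intro: img)
      show "norm (g (1 - v) - g (1 - u)) \<le> B (1 - v) - B (1 - u)"
        if "0 \<le> u" "u \<le> v" "v \<le> 1 - s" for u v
        using incB[of "1 - v" "1 - u"] that s by (simp add: norm_minus_commute)
    qed (use s nonneg in \<open>auto intro!: f d bound img\<close>)
    also have "\<dots> \<le> Q" using s nonneg l by (intro Q) auto
    finally show ?thesis by (simp add: norm_minus_commute)
  qed
  have F: "continuous_on {0..1} (\<lambda>s. f (g s))"
  proof (rule continuous_on_compose2[OF _ cont])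
    show "continuous_on (path_image g) f"
      using f differentiable_imp_continuous_within by (blast intro: continuous_at_imp_continuous_on)
  qed (auto intro: img)
  \<comment> \<open>A point with \<open>A = B\<close> would call for continuity of the lengths.
    Instead, the parameters satisfying either half estimate form two closed sets covering the
    interval, which meet by connectedness.\<close>
  define U where "U = {s \<in> {0..1::real}. norm (f (g s) - f (g 0)) \<le> Q}"
  define V where "V = {s \<in> {0..1::real}. norm (f (g 1) - f (g s)) \<le> Q}"
  have "0 \<le> Q" using C \<alpha> by (simp add: Q_def)
  have "closed U" "closed V"
    unfolding U_def V_def by (intro continuous_on_closed_Collect_le continuous_intros F closed_atLeastAtMost)+
  moreover have "{0..1} \<subseteq> U \<union> V"
    using left right by (force simp: U_def V_def)
  moreover have "0 \<in> U" "1 \<in> V" using \<open>0 \<le> Q\<close> by (simp_all add: U_def V_def)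
  ultimately obtain m where "m \<in> U" "m \<in> V"
    using connected_closedD[OF connected_Icc[of 0 1], of U V] by fastforce
  then have "norm (f (g 1) - f (g 0)) \<le> 2 * Q"
    using norm_triangle_ineq[of "f (g 1) - f (g m)" "f (g m) - f (g 0)"] by (simp add: U_def V_def)
  then show ?thesis by (simp add: pathstart_def pathfinish_def Q_def)
qed

text \<open>An open singleton would have empty frontier, so \<open>D\<close> has two distinct
  points; comparing an arc with its chord then shows that \<open>c\<close> is positive.\<close>

lemma uniform_domain_obtain:
  fixes D :: "'a::real_normed_vector set"
  assumes "uniform_domain c D"
  obtains z w where "z \<in> D" "w \<in> D" "z \<noteq> w" "0 < c"
proof -
  have D: "open D" "D \<noteq> {}" "frontier D \<noteq> {}"
    using assms by (auto simp: uniform_domain_def domain_set_def)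
  then obtain z where z: "z \<in> D" by blast
  have "\<not> D \<subseteq> {z}"
  proof
    assume "D \<subseteq> {z}"
    then have "D = {z}" using z by blast
    then show False using D(1) infdist_frontier_pos[OF D(1,3) z] D(3) by (simp add: frontier_def)
  qed
  then obtain w where w: "w \<in> D" "z \<noteq> w" by blast
  then obtain g where "pathstart g = z" "pathfinish g = w" "curve_length g 0 1 \<le> ereal (c * norm (z - w))"
    using assms z unfolding uniform_domain_def by blast
  then have "ereal (norm (w - z)) \<le> ereal (c * norm (z - w))"
    using norm_le_curve_length[of 0 1 g] order_trans by (fastforce simp: pathstart_def pathfinish_def)
  moreover have "0 < norm (w - z)" using w by simp
  ultimately have "0 < c * norm (z - w)" by (simp only: ereal_less_eq)
  then have "0 < c" using w by (simp add: zero_less_mult_iff)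
  with z w show thesis by (intro that)
qed

theorem theorem3p6:
  fixes f :: "'a::complex_normed_vector \<Rightarrow> 'b::complex_normed_vector"
    and D :: "'a set" and c \<alpha> :: real
  assumes "0 < \<alpha>" and "\<alpha> < 1"
    and "uniform_domain c D"
    and "analytic_mapping_on f D"
  shows "((\<exists>C. \<forall>z\<in>D. onorm (frechet_derivative f (at z)) \<le> C * infdist z (frontier D) powr (\<alpha> - 1))
          \<longleftrightarrow> (\<exists>C'. \<forall>z\<in>D. \<forall>w\<in>D. norm (f z - f w) \<le> C' * norm (z - w) powr \<alpha>))
    \<and> (\<forall>C. (\<forall>z\<in>D. onorm (frechet_derivative f (at z)) \<le> C * infdist z (frontier D) powr (\<alpha> - 1))
          \<longrightarrow> (\<exists>C'. C' \<le> 2 * c / \<alpha> * C \<and>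
                (\<forall>z\<in>D. \<forall>w\<in>D. norm (f z - f w) \<le> C' * norm (z - w) powr \<alpha>)))
    \<and> (\<forall>C'. (\<forall>z\<in>D. \<forall>w\<in>D. norm (f z - f w) \<le> C' * norm (z - w) powr \<alpha>)
          \<longrightarrow> (\<exists>C. C \<le> C' \<and>
                (\<forall>z\<in>D. onorm (frechet_derivative f (at z)) \<le> C * infdist z (frontier D) powr (\<alpha> - 1))))"
proof -
  let ?d = "\<lambda>z. infdist z (frontier D)"
  let ?P = "\<lambda>C. \<forall>z\<in>D. onorm (frechet_derivative f (at z)) \<le> C * ?d z powr (\<alpha> - 1)"
  let ?H = "\<lambda>C'. \<forall>z\<in>D. \<forall>w\<in>D. norm (f z - f w) \<le> C' * norm (z - w) powr \<alpha>"
  note \<alpha> = assms(1,2)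
  have D: "open D" "frontier D \<noteq> {}"
    using assms(3) by (auto simp: uniform_domain_def domain_set_def)
  obtain z\<^sub>0 w\<^sub>0 where zw0: "z\<^sub>0 \<in> D" "w\<^sub>0 \<in> D" "z\<^sub>0 \<noteq> w\<^sub>0" and c: "0 < c"
    using uniform_domain_obtain[OF assms(3)] .
  note df = analytic_mapping_on_derivative(1)[OF assms(4)]
  note d_pos = infdist_frontier_pos[OF D]
  have fwd: "?H (2 * c / \<alpha> * C)" if P: "?P C" for C
  proof (intro ballI)
    fix z w assume zw: "z \<in> D" "w \<in> D"
    \<comment> \<open>The operator norm is nonnegative and the power of the distance positive, which
      forces the sign of \<open>C\<close>.\<close>
    have "0 \<le> C * ?d z powr (\<alpha> - 1)"
      using P zw onorm_pos_le[OF has_derivative_bounded_linear[OF df[OF zw(1)]]] by (meson order_trans)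
    then have C: "0 \<le> C" using d_pos[OF zw(1)] by (simp add: zero_le_mult_iff)
    show "norm (f z - f w) \<le> 2 * c / \<alpha> * C * norm (z - w) powr \<alpha>"
    proof (cases "z = w")
      case False
      then obtain g where g: "rectifiable_arc g" "path_image g \<subseteq> D" "pathstart g = z" "pathfinish g = w"
          "curve_length g 0 1 \<le> ereal (c * norm (z - w))"
          "\<And>s. s \<in> {0..1} \<Longrightarrow> min (curve_length g 0 s) (curve_length g s 1) \<le> ereal (c * ?d (g s))"
        using assms(3) zw unfolding uniform_domain_def by metis
      have "norm (f (pathfinish g) - f (pathstart g))
          \<le> 2 * C * c powr (1 - \<alpha>) / \<alpha> * (c * norm (z - w)) powr \<alpha>"
      proof (rule holder_of_uniform_arc[OF \<alpha> c C _ _ _ _ _ g(5) g(6)])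
        show "path g" using g(1) by (simp add: rectifiable_arc_def arc_imp_path)
        show "continuous_on (path_image g) ?d" by (intro continuous_intros)
        show "f differentiable at y" if "y \<in> path_image g" for y
          using df that g(2) by (blast intro: differentiableI)
      qed (use P g(2) d_pos in auto)
      also have "\<dots> = 2 * C * (c powr (1 - \<alpha>) * c powr \<alpha>) / \<alpha> * norm (z - w) powr \<alpha>"
        using c by (simp add: powr_mult)
      \<comment> \<open>The power from comparing distance with length and the one from the length
        bound combine to the factor \<open>c\<close> of the claim.\<close>
      also have "c powr (1 - \<alpha>) * c powr \<alpha> = c" using c by (simp add: powr_add[symmetric])
      finally show ?thesis by (simp add: g(3,4) norm_minus_commute mult.commute mult.left_commute)
    qed simp
  qed
  have bwd: "?P C" if H: "?H C" for C
  proof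
    fix z assume z: "z \<in> D"
    \<comment> \<open>Two distinct points are needed here: for equal points the right side is 0
      whatever the sign of \<open>C\<close>.\<close>
    have "0 \<le> C * norm (z\<^sub>0 - w\<^sub>0) powr \<alpha>" using H zw0 norm_ge_zero order_trans by blast
    then have C: "0 \<le> C" using zw0(3) by (simp add: zero_le_mult_iff)
    show "onorm (frechet_derivative f (at z)) \<le> C * ?d z powr (\<alpha> - 1)"
    proof (rule onorm_bound)
      fix \<zeta>
      \<comment> \<open>Only the open ball of radius \<open>?d z\<close> is known to lie in
        \<open>D\<close>, so the Cauchy inequality is used on smaller closed balls and
        \<open>r\<close> then tends to \<open>?d z\<close> from the left.\<close>
      have r: "norm (frechet_derivative f (at z) \<zeta>) \<le> C * r powr (\<alpha> - 1) * norm \<zeta>"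
        if "r \<in> {0<..<?d z}" for r
      proof -
        have sub: "cball z r \<subseteq> D"
          using ball_infdist_frontier_subset[OF z d_pos[OF z]] that by (force simp: cball_def ball_def)
        have "norm (frechet_derivative f (at z) \<zeta>) \<le> C * r powr \<alpha> / r * norm \<zeta>"
        proof (rule analytic_mapping_Cauchy_inequality[OF assms(4) _ sub])
          fix w assume w: "norm (w - z) = r"
          then have "w \<in> D" using sub by (auto simp: dist_norm norm_minus_commute)
          then show "norm (f w - f z) \<le> C * r powr \<alpha>" using H z w by blast
        qed (use that in simp)
        then show ?thesis using that by (simp add: powr_diff)
      qed
      show "norm (frechet_derivative f (at z) \<zeta>) \<le> C * ?d z powr (\<alpha> - 1) * norm \<zeta>"
      proof (rule tendsto_lowerbound)
        show "((\<lambda>r. C * r powr (\<alpha> - 1) * norm \<zeta>) \<longlongrightarrow> C * ?d z powr (\<alpha> - 1) * norm \<zeta>) (at_left (?d z))"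
          using d_pos[OF z] by (intro tendsto_intros) auto
        show "\<forall>\<^sub>F r in at_left (?d z).
            norm (frechet_derivative f (at z) \<zeta>) \<le> C * r powr (\<alpha> - 1) * norm \<zeta>"
          using r d_pos[OF z] by (intro eventually_at_leftI) auto
      qed simp
    qed (use C in simp)
  qed
  \<comment> \<open>The claimed upper bounds themselves serve as the constants.\<close>
  show ?thesis using fwd bwd by blast
qed

end
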